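(* Let $V$ be a finite set and $\sigma,\beta\in\mathbb R$. Let $G$ be the Poisson probability kernel, mapping functions $f:\mathbb N\to\mathbb R$ to functions $$Gf(z)=\sum_{n=0}^\infty f(n)\frac{z^n}{n!}e^{-z},\qquad z\in\mathbb R,$$ and let $G^{\otimes}=\otimes_{x\in V}G^{(x)}$ be the tensorized operator mapping functions $f:\mathbb N^V\to\mathbb R$ to functions on $\mathbb R^V$, $$G^\otimes f(z)=\sum_{n\in\mathbb N^V}f(n)\prod_{x\in V}\frac{z_x^{n_x}}{n_x!}e^{-z_x},\qquad z\in\mathbb R^V.$$ Then, for every $f:\mathbb N^V\to\mathbb R$ for which this series converges absolutely for every $z\in\mathbb R^V$ and defines a real analytic function, $\mathscr L^{\sigma,\beta}$ and $L^{\sigma,\beta}$ are intertwined with intertwiner $G^\otimes$, namely $$\mathscr L^{\sigma,\beta}G^\otimes f(z)=G^\otimes L^{\sigma,\beta}f(z),\qquad z\in\mathbb R^V.$$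
   Context: Let $p:V\times V\to[0,\infty)$ with $p(x,x)=0$ for all $x\in V$, and irreducible (for all $x,y\in V$ there exist $x_1=x,\dots,x_m=y$ with $\prod_{l=1}^{m-1}p(x_l,x_{l+1})>0$). On functions $f:\mathbb N^V\to\mathbb R$, $L^{\sigma,\beta}f(\eta)=\sum_{x,y\in V}p(x,y)L^{\sigma,\beta}_{x,y}f(\eta)$ with $$L^{\sigma,\beta}_{x,y}f(\eta)=\eta_x(\beta+\sigma\eta_y)(f(\eta^{x,y})-f(\eta))+\eta_y(\beta+\sigma\eta_x)(f(\eta^{y,x})-f(\eta)),$$ where $\eta^{x,y}$ is $\eta$ with one particle moved from $x$ to $y$ (a term with prefactor $0$ vanishes). On real analytic functions $f:\mathbb R^V\to\mathbb R$, $\mathscr L^{\sigma,\beta}f(z)=\sum_{x,y\in V}p(x,y)\mathscr L^{\sigma,\beta}_{x,y}f(z)$ with $$\mathscr L^{\sigma,\beta}_{x,y}f(z)=\left(-\beta(z_x-z_y)(\partial_x-\partial_y)+\sigma z_xz_y(\partial_x-\partial_y)^2\right)f(z).$$ *)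

theory Defs
  imports "HOL-Analysis.Analysis"
begin

text \<open>Configurations in \<open>\<nat>\<^sup>V\<close> are functions \<open>'v \<Rightarrow> nat\<close>, points of \<open>\<real>\<^sup>V\<close> are
  vectors \<open>real ^ 'v\<close>, for a finite type \<open>'v\<close> of sites.\<close>

definition irreducible_rates :: "('v \<Rightarrow> 'v \<Rightarrow> real) \<Rightarrow> bool" where
  "irreducible_rates p \<longleftrightarrow>
     (\<forall>x y. \<exists>xs. xs \<noteq> [] \<and> hd xs = x \<and> last xs = y \<and>
        (\<Prod>l<length xs - 1. p (xs ! l) (xs ! Suc l)) > 0)"

text \<open>If \<open>\<eta> x = 0\<close>, the truncated subtraction makes the value below meaningless; in the
  generator it then only occurs with prefactor \<open>\<eta> x = 0\<close>.\<close>

definition move_particle :: "'v \<Rightarrow> 'v \<Rightarrow> ('v \<Rightarrow> nat) \<Rightarrow> 'v \<Rightarrow> nat" where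
  "move_particle x y \<eta> = (let \<eta>' = \<eta>(x := \<eta> x - 1) in \<eta>'(y := \<eta>' y + 1))"

definition particle_edge_gen ::
  "real \<Rightarrow> real \<Rightarrow> 'v \<Rightarrow> 'v \<Rightarrow> (('v \<Rightarrow> nat) \<Rightarrow> real) \<Rightarrow> ('v \<Rightarrow> nat) \<Rightarrow> real" where
  "particle_edge_gen \<sigma> \<beta> x y f \<eta> =
     real (\<eta> x) * (\<beta> + \<sigma> * real (\<eta> y)) * (f (move_particle x y \<eta>) - f \<eta>)
   + real (\<eta> y) * (\<beta> + \<sigma> * real (\<eta> x)) * (f (move_particle y x \<eta>) - f \<eta>)"

definition particle_gen ::
  "('v::finite \<Rightarrow> 'v \<Rightarrow> real) \<Rightarrow> real \<Rightarrow> real \<Rightarrow> (('v \<Rightarrow> nat) \<Rightarrow> real) \<Rightarrow> ('v \<Rightarrow> nat) \<Rightarrow> real" where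
  "particle_gen p \<sigma> \<beta> f \<eta> =
     (\<Sum>x\<in>UNIV. \<Sum>y\<in>UNIV. p x y * particle_edge_gen \<sigma> \<beta> x y f \<eta>)"

definition partial :: "'v::finite \<Rightarrow> (real ^ 'v \<Rightarrow> real) \<Rightarrow> real ^ 'v \<Rightarrow> real" where
  "partial x f z = deriv (\<lambda>t. f (z + t *\<^sub>R axis x 1)) 0"

definition partial_diff :: "'v::finite \<Rightarrow> 'v \<Rightarrow> (real ^ 'v \<Rightarrow> real) \<Rightarrow> real ^ 'v \<Rightarrow> real" where
  "partial_diff x y f z = partial x f z - partial y f z"

definition diffusion_edge_gen ::
  "real \<Rightarrow> real \<Rightarrow> 'v::finite \<Rightarrow> 'v \<Rightarrow> (real ^ 'v \<Rightarrow> real) \<Rightarrow> real ^ 'v \<Rightarrow> real" where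
  "diffusion_edge_gen \<sigma> \<beta> x y f z =
     - \<beta> * (z $ x - z $ y) * partial_diff x y f z
     + \<sigma> * z $ x * z $ y * partial_diff x y (partial_diff x y f) z"

definition diffusion_gen ::
  "('v::finite \<Rightarrow> 'v \<Rightarrow> real) \<Rightarrow> real \<Rightarrow> real \<Rightarrow> (real ^ 'v \<Rightarrow> real) \<Rightarrow> real ^ 'v \<Rightarrow> real" where
  "diffusion_gen p \<sigma> \<beta> f z =
     (\<Sum>x\<in>UNIV. \<Sum>y\<in>UNIV. p x y * diffusion_edge_gen \<sigma> \<beta> x y f z)"

text \<open>Local expansion into a multivariate power series at every point; the sum over
  multi-indices is unconditional, hence absolutely convergent.\<close>

definition real_analytic :: "(real ^ 'v::finite \<Rightarrow> real) \<Rightarrow> bool" where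
  "real_analytic f \<longleftrightarrow>
     (\<forall>a. \<exists>r>0. \<exists>c :: ('v \<Rightarrow> nat) \<Rightarrow> real. \<forall>z\<in>ball a r.
        ((\<lambda>k. c k * (\<Prod>x\<in>UNIV. (z $ x - a $ x) ^ k x)) has_sum f z) UNIV)"

text \<open>The kernel of the single-site operator \<open>G f z = (\<Sum>n. f n * poisson_weight n z)\<close>.
  The argument \<open>z\<close> ranges over all reals, so the weights may be negative.\<close>

definition poisson_weight :: "nat \<Rightarrow> real \<Rightarrow> real" where
  "poisson_weight n z = z ^ n / fact n * exp (- z)"

definition poisson_tensor_term ::
  "(('v::finite \<Rightarrow> nat) \<Rightarrow> real) \<Rightarrow> real ^ 'v \<Rightarrow> ('v \<Rightarrow> nat) \<Rightarrow> real" where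
  "poisson_tensor_term f z n = f n * (\<Prod>x\<in>UNIV. poisson_weight (n x) (z $ x))"

definition poisson_tensor :: "(('v::finite \<Rightarrow> nat) \<Rightarrow> real) \<Rightarrow> real ^ 'v \<Rightarrow> real" where
  "poisson_tensor f z = (\<Sum>\<^sub>\<infinity>n. poisson_tensor_term f z n)"

end

theory Submission
  imports Defs
begin

text \<open>The Poisson kernel turns the differential operators into difference operators: with
  \<open>S\<^sub>x f (n) = f (n + e\<^sub>x)\<close> (\<open>shift_up\<close>)
  and \<open>M\<^sub>x f (n) = n\<^sub>x f (n - e\<^sub>x)\<close> (\<open>shift_down\<close>) one has \<open>\<partial>\<^sub>x G f = G (S\<^sub>x f - f)\<close>
  and \<open>z\<^sub>x G f = G (M\<^sub>x f)\<close>. Hence \<open>\<partial>\<^sub>x - \<partial>\<^sub>y\<close> corresponds to \<open>S\<^sub>x - S\<^sub>y\<close>, and the generator of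
  the particle system is the image of the diffusion generator under this dictionary.\<close>

definition shift_up :: "'v \<Rightarrow> (('v \<Rightarrow> nat) \<Rightarrow> real) \<Rightarrow> ('v \<Rightarrow> nat) \<Rightarrow> real" where
  "shift_up x f n = f (n(x := Suc (n x)))"

definition shift_down :: "'v \<Rightarrow> (('v \<Rightarrow> nat) \<Rightarrow> real) \<Rightarrow> ('v \<Rightarrow> nat) \<Rightarrow> real" where
  "shift_down x f n = real (n x) * f (n(x := n x - 1))"

section \<open>Summability and linearity of the Poisson transform\<close>

text \<open>Summability is demanded at all points at once because this class is closed under
  \<open>shift_up\<close>: the terms of the shifted function at \<open>z\<close> are controlled by
  those of \<open>f\<close> at a different point. For real terms, unconditional and absolute
  summability coincide.\<close>

definition poisson_summable :: "(('v::finite \<Rightarrow> nat) \<Rightarrow> real) \<Rightarrow> bool" where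
  "poisson_summable f \<longleftrightarrow> (\<forall>z. poisson_tensor_term f z summable_on UNIV)"

lemma poisson_summableD: "poisson_summable f \<Longrightarrow> poisson_tensor_term f z summable_on UNIV"
  by (simp add: poisson_summable_def)

lemma poisson_summable_iff_abs:
  "poisson_summable f \<longleftrightarrow> (\<forall>z. (\<lambda>n. \<bar>poisson_tensor_term f z n\<bar>) summable_on UNIV)"
  using summable_on_iff_abs_summable_on_real
  by (auto simp: poisson_summable_def)

lemma poisson_tensor_term_add:
  "poisson_tensor_term (\<lambda>n. f n + g n) z = (\<lambda>n. poisson_tensor_term f z n + poisson_tensor_term g z n)"
  by (simp add: poisson_tensor_term_def fun_eq_iff distrib_right)

lemma poisson_tensor_term_cmult:
  "poisson_tensor_term (\<lambda>n. c * f n) z = (\<lambda>n. c * poisson_tensor_term f z n)"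
  by (simp add: poisson_tensor_term_def fun_eq_iff)

lemma poisson_summable_add:
  "poisson_summable f \<Longrightarrow> poisson_summable g \<Longrightarrow> poisson_summable (\<lambda>n. f n + g n)"
  by (simp add: poisson_summable_def poisson_tensor_term_add summable_on_add)

lemma poisson_summable_cmult: "poisson_summable f \<Longrightarrow> poisson_summable (\<lambda>n. c * f n)"
  by (simp add: poisson_summable_def poisson_tensor_term_cmult summable_on_cmult_right)

lemma poisson_summable_diff:
  "poisson_summable f \<Longrightarrow> poisson_summable g \<Longrightarrow> poisson_summable (\<lambda>n. f n - g n)"
  using poisson_summable_add[of f "\<lambda>n. (-1) * g n"] poisson_summable_cmult[of g "-1"] by simp

lemma poisson_tensor_add:
  "poisson_summable f \<Longrightarrow> poisson_summable g \<Longrightarrow>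
    poisson_tensor (\<lambda>n. f n + g n) z = poisson_tensor f z + poisson_tensor g z"
  by (simp add: poisson_tensor_def poisson_tensor_term_add infsum_add poisson_summableD)

lemma poisson_tensor_cmult: "poisson_tensor (\<lambda>n. c * f n) z = c * poisson_tensor f z"
  by (simp add: poisson_tensor_def poisson_tensor_term_cmult infsum_cmult_right')

lemma poisson_tensor_diff:
  "poisson_summable f \<Longrightarrow> poisson_summable g \<Longrightarrow>
    poisson_tensor (\<lambda>n. f n - g n) z = poisson_tensor f z - poisson_tensor g z"
  using poisson_tensor_add[of f "\<lambda>n. (-1) * g n"] poisson_summable_cmult[of g "-1"]
    poisson_tensor_cmult[of "-1" g] by simp

lemma poisson_summable_zero: "poisson_summable (\<lambda>n. 0)"
  by (simp add: poisson_summable_def poisson_tensor_term_def[abs_def])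

lemma poisson_summable_sum:
  assumes "finite A" "\<And>i. i \<in> A \<Longrightarrow> poisson_summable (f i)"
  shows "poisson_summable (\<lambda>n. \<Sum>i\<in>A. f i n)"
  using assms by (induction A) (auto simp: poisson_summable_zero intro!: poisson_summable_add)

lemma poisson_tensor_sum:
  assumes "finite A" "\<And>i. i \<in> A \<Longrightarrow> poisson_summable (f i)"
  shows "poisson_tensor (\<lambda>n. \<Sum>i\<in>A. f i n) z = (\<Sum>i\<in>A. poisson_tensor (f i) z)"
  using assms
proof (induction A)
  case empty
  show ?case by (simp add: poisson_tensor_def poisson_tensor_term_def)
next
  case (insert i A)
  then show ?case by (simp add: poisson_tensor_add poisson_summable_sum)
qed

section \<open>Poisson weights and the shift operators\<close>

lemma prod_poisson_weight_split:
  fixes z :: "real ^ 'v::finite"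
  shows "(\<Prod>v\<in>UNIV. poisson_weight (n v) (z $ v)) =
    poisson_weight (n x) (z $ x) * (\<Prod>v\<in>-{x}. poisson_weight (n v) (z $ v))"
  by (simp add: prod.remove[of UNIV x] Compl_eq_Diff_UNIV)

lemma poisson_weight_Suc: "real (Suc k) * poisson_weight (Suc k) u = u * poisson_weight k u"
  by (simp add: poisson_weight_def del: of_nat_Suc)

lemma Suc_le_two_power: "Suc k \<le> 2 ^ k"
  by (induction k) auto

text \<open>Needed for \<open>shift_up\<close>. Passing from weight k+1 to weight k at the same
  point costs a factor (k+1)/|u|, unbounded in k, so the larger point 2|u|+1 is used. Its factor 2
  absorbs k+1 \<le> 2^k, and its summand 1 makes the base at least 1, which allows one more power
  and covers u = 0. The constant compensates for the change in the exponential.\<close>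

lemma abs_poisson_weight_le:
  "\<bar>poisson_weight k u\<bar> \<le> exp (3 * \<bar>u\<bar> + 1) * \<bar>poisson_weight (Suc k) (2 * \<bar>u\<bar> + 1)\<bar>"
proof -
  have "real (Suc k) * \<bar>u\<bar> ^ k \<le> 2 ^ k * \<bar>u\<bar> ^ k"
    using Suc_le_two_power[of k] by (intro mult_right_mono) (metis of_nat_le_iff of_nat_numeral of_nat_power, simp)
  also have "\<dots> = (2 * \<bar>u\<bar>) ^ k" by (simp add: power_mult_distrib)
  also have "\<dots> \<le> (2 * \<bar>u\<bar> + 1) ^ k" by (intro power_mono) auto
  also have "\<dots> \<le> (2 * \<bar>u\<bar> + 1) ^ Suc k" by (rule power_increasing) auto
  finally have *: "real (Suc k) * \<bar>u\<bar> ^ k \<le> (2 * \<bar>u\<bar> + 1) ^ Suc k" .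
  have "\<bar>poisson_weight k u\<bar> = \<bar>u\<bar> ^ k / fact k * exp (- u)"
    by (simp add: poisson_weight_def abs_mult power_abs)
  also have "\<dots> = (real (Suc k) * \<bar>u\<bar> ^ k) / fact (Suc k) * exp (- u)"
    by (simp del: of_nat_Suc)
  also have "\<dots> \<le> (2 * \<bar>u\<bar> + 1) ^ Suc k / fact (Suc k) * exp \<bar>u\<bar>"
    using * by (intro mult_mono divide_right_mono) auto
  also have "exp \<bar>u\<bar> = exp (3 * \<bar>u\<bar> + 1) * exp (- (2 * \<bar>u\<bar> + 1))"
    by (simp flip: exp_add)
  finally show ?thesis
    by (simp add: poisson_weight_def abs_mult power_abs mult_ac)
qed

lemma inj_increment: "inj (\<lambda>n :: 'v \<Rightarrow> nat. n(x := Suc (n x)))"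
proof (rule injI)
  fix m n :: "'v \<Rightarrow> nat"
  assume eq: "m(x := Suc (m x)) = n(x := Suc (n x))"
  show "m = n"
  proof
    fix v show "m v = n v" using fun_cong[OF eq, of v] by (auto split: if_splits)
  qed
qed

text \<open>Comparison: up to a constant, the terms at \<open>z\<close> are dominated by the terms
  of \<open>f\<close> at \<open>z'\<close>, taken along the injective map that adds a particle at
  \<open>x\<close>.\<close>

lemma poisson_summable_shift_up:
  fixes f :: "('v::finite \<Rightarrow> nat) \<Rightarrow> real"
  assumes "poisson_summable f"
  shows "poisson_summable (shift_up x f)"
  unfolding poisson_summable_def
proof
  fix z :: "real ^ 'v"
  define u where "u = 2 * \<bar>z $ x\<bar> + 1"
  define z' where "z' = (\<chi> v. if v = x then u else z $ v)"
  define h where "h = (\<lambda>n :: 'v \<Rightarrow> nat. n(x := Suc (n x)))"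
  have "inj h"
    unfolding h_def by (rule inj_increment)
  have "(\<lambda>n. \<bar>poisson_tensor_term f z' n\<bar>) summable_on UNIV"
    using assms by (simp add: poisson_summable_iff_abs)
  hence "(\<lambda>n. \<bar>poisson_tensor_term f z' n\<bar>) summable_on range h"
    by (rule summable_on_subset_banach) simp
  hence "(\<lambda>n. \<bar>poisson_tensor_term f z' (h n)\<bar>) summable_on UNIV"
    by (subst (asm) summable_on_reindex[OF \<open>inj h\<close>]) (simp add: o_def)
  hence *: "(\<lambda>n. exp (3 * \<bar>z $ x\<bar> + 1) * \<bar>poisson_tensor_term f z' (h n)\<bar>) summable_on UNIV"
    by (rule summable_on_cmult_right)
  show "poisson_tensor_term (shift_up x f) z summable_on UNIV"
  proof (rule abs_summable_summable, rule summable_on_comparison_test[OF *])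
    fix n
    define R where "R = (\<Prod>v\<in>-{x}. poisson_weight (n v) (z $ v))"
    \<comment> \<open>\<open>z'\<close> and \<open>h n\<close> differ from \<open>z\<close> and
      \<open>n\<close> only at \<open>x\<close>, so the other sites contribute the same
      factor.\<close>
    have 1: "(\<Prod>v\<in>-{x}. poisson_weight (h n v) (z' $ v)) = R"
      unfolding R_def by (intro prod.cong) (auto simp: h_def z'_def)
    have "norm (poisson_tensor_term (shift_up x f) z n) = \<bar>f (h n)\<bar> * (\<bar>poisson_weight (n x) (z $ x)\<bar> * \<bar>R\<bar>)"
      by (simp add: poisson_tensor_term_def prod_poisson_weight_split[where x = x] R_def
          shift_up_def h_def abs_mult)
    also have "\<dots> \<le> \<bar>f (h n)\<bar> * ((exp (3 * \<bar>z $ x\<bar> + 1) * \<bar>poisson_weight (Suc (n x)) u\<bar>) * \<bar>R\<bar>)"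
      unfolding u_def by (intro mult_left_mono mult_right_mono abs_poisson_weight_le) auto
    also have "\<dots> = exp (3 * \<bar>z $ x\<bar> + 1) * \<bar>poisson_tensor_term f z' (h n)\<bar>"
      unfolding poisson_tensor_term_def prod_poisson_weight_split[where x = x] 1
      by (simp add: h_def z'_def abs_mult)
    finally show "norm (poisson_tensor_term (shift_up x f) z n)
      \<le> exp (3 * \<bar>z $ x\<bar> + 1) * \<bar>poisson_tensor_term f z' (h n)\<bar>" .
  qed auto
qed

text \<open>Reindexing by adding a particle at \<open>x\<close> and using
  \<open>poisson_weight_Suc\<close> takes the factor \<open>z $ x\<close> out of each term. The
  \<open>has_sum\<close> form yields both the summability and the value.\<close>

lemma has_sum_shift_down:
  fixes z :: "real ^ 'v::finite"
  assumes "poisson_summable f"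
  shows "(poisson_tensor_term (shift_down x f) z has_sum z $ x * poisson_tensor f z) UNIV"
proof -
  define h where "h = (\<lambda>n :: 'v \<Rightarrow> nat. n(x := Suc (n x)))"
  have "inj h"
    unfolding h_def by (rule inj_increment)
  have eq: "poisson_tensor_term (shift_down x f) z (h n) = z $ x * poisson_tensor_term f z n" for n
  proof -
    have 1: "(\<Prod>v\<in>-{x}. poisson_weight (h n v) (z $ v)) = (\<Prod>v\<in>-{x}. poisson_weight (n v) (z $ v))"
      by (intro prod.cong) (auto simp: h_def)
    have "poisson_tensor_term (shift_down x f) z (h n)
       = f n * (real (Suc (n x)) * poisson_weight (Suc (n x)) (z $ x))
         * (\<Prod>v\<in>-{x}. poisson_weight (n v) (z $ v))"
      unfolding poisson_tensor_term_def prod_poisson_weight_split[where x = x] 1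
      by (simp add: h_def shift_down_def)
    then show ?thesis
      unfolding poisson_weight_Suc poisson_tensor_term_def prod_poisson_weight_split[where x = x]
      by simp
  qed
  have "(poisson_tensor_term f z has_sum poisson_tensor f z) UNIV"
    unfolding poisson_tensor_def using assms by (intro has_sum_infsum poisson_summableD)
  hence "((\<lambda>n. poisson_tensor_term (shift_down x f) z (h n)) has_sum z $ x * poisson_tensor f z) UNIV"
    unfolding eq by (rule has_sum_cmult_right)
  hence 2: "(poisson_tensor_term (shift_down x f) z has_sum z $ x * poisson_tensor f z) (range h)"
    by (subst has_sum_reindex[OF \<open>inj h\<close>]) (simp add: o_def)
  \<comment> \<open>Configurations missed by \<open>h\<close> have no particle at \<open>x\<close>;
    there the prefactor of \<open>shift_down\<close> is zero, whatever the truncated subtraction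
    gives.\<close>
  have "poisson_tensor_term (shift_down x f) z n = 0" if "n \<notin> range h" for n
  proof -
    have "n x = 0"
    proof (rule ccontr)
      assume "n x \<noteq> 0"
      hence "n = h (n(x := n x - 1))" by (auto simp: h_def)
      with that show False by blast
    qed
    then show ?thesis by (simp add: poisson_tensor_term_def shift_down_def)
  qed
  then show ?thesis
    using 2 by (subst has_sum_cong_neutral[where T = "range h"]) auto
qed

lemma poisson_summable_shift_down: "poisson_summable f \<Longrightarrow> poisson_summable (shift_down x f)"
  unfolding poisson_summable_def[of "shift_down x f"]
  using has_sum_shift_down has_sum_imp_summable by blast

lemma poisson_tensor_shift_down:
  "poisson_summable f \<Longrightarrow> poisson_tensor (shift_down x f) z = z $ x * poisson_tensor f z"
  unfolding poisson_tensor_def[of "shift_down x f"]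
  using has_sum_shift_down infsumI by blast

section \<open>Differentiation in one coordinate\<close>

text \<open>The sum over all sites but \<open>x\<close>, with k particles at \<open>x\<close>.
  Configurations on the other sites are encoded by \<open>m x = 0\<close>. The value does not depend
  on \<open>z $ x\<close>.\<close>

definition site_coeff :: "'v::finite \<Rightarrow> (('v \<Rightarrow> nat) \<Rightarrow> real) \<Rightarrow> real ^ 'v \<Rightarrow> nat \<Rightarrow> real" where
  "site_coeff x f z k =
     (\<Sum>\<^sub>\<infinity>m\<in>{m. m x = 0}. f (m(x := k)) * (\<Prod>v\<in>-{x}. poisson_weight (m v) (z $ v)))"

lemma site_coeff_shift_up: "site_coeff x (shift_up x f) z k = site_coeff x f z (Suc k)"
  by (simp add: site_coeff_def shift_up_def)

text \<open>Fubini: a configuration is a pair of its occupation number at \<open>x\<close> and its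
  remainder, and the remainder is summed first.\<close>

lemma site_coeff_sums:
  fixes z :: "real ^ 'v::finite"
  assumes "poisson_summable f"
  shows "(\<lambda>k. site_coeff x f z k * poisson_weight k u) sums
    poisson_tensor f (\<chi> v. if v = x then u else z $ v)"
proof -
  define z' where "z' = (\<chi> v. if v = x then u else z $ v)"
  define M where "M = {m :: 'v \<Rightarrow> nat. m x = 0}"
  define h where "h = (\<lambda>(k, m :: 'v \<Rightarrow> nat). m(x := k :: nat))"
  define R where "R = (\<lambda>m. \<Prod>v\<in>-{x}. poisson_weight (m v) (z $ v))"
  have bij: "bij_betw h (UNIV \<times> M) UNIV"
  proof (rule bij_betw_byWitness[where f' = "\<lambda>n. (n x, n(x := 0))"])
    show "\<forall>a\<in>UNIV \<times> M. ((h a) x, (h a)(x := 0)) = a"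
      by (auto simp: h_def M_def fun_eq_iff)
  qed (auto simp: h_def M_def)
  have eq: "poisson_tensor_term f z' (h (k, m)) = f (m(x := k)) * R m * poisson_weight k u" for k m
  proof -
    have 1: "(\<Prod>v\<in>-{x}. poisson_weight (h (k, m) v) (z' $ v)) = R m"
      unfolding R_def by (intro prod.cong) (auto simp: h_def z'_def)
    show ?thesis
      unfolding poisson_tensor_term_def prod_poisson_weight_split[where x = x] 1
      by (simp add: h_def z'_def)
  qed
  have "(poisson_tensor_term f z' has_sum poisson_tensor f z') UNIV"
    unfolding poisson_tensor_def using assms by (intro has_sum_infsum poisson_summableD)
  hence hs: "((\<lambda>a. poisson_tensor_term f z' (h a)) has_sum poisson_tensor f z') (UNIV \<times> M)"
    by (simp add: has_sum_reindex_bij_betw[OF bij])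
  hence "(\<lambda>(k, m). poisson_tensor_term f z' (h (k, m))) summable_on (UNIV \<times> M)"
    by (simp add: case_prod_unfold has_sum_imp_summable)
  hence "(\<lambda>m. poisson_tensor_term f z' (h (k, m))) summable_on M" for k
    by (rule summable_on_SigmaD1) simp
  \<comment> \<open>The weight is pulled out of the infinite sum by a rule without side condition,
    so a vanishing weight (u = 0, k > 0) is no exception.\<close>
  hence "((\<lambda>m. poisson_tensor_term f z' (h (k, m))) has_sum site_coeff x f z k * poisson_weight k u) M" for k
    using has_sum_infsum[of "\<lambda>m. poisson_tensor_term f z' (h (k, m))" M for k]
    by (simp add: eq infsum_cmult_left' site_coeff_def R_def M_def)
  hence "((\<lambda>k. site_coeff x f z k * poisson_weight k u) has_sum poisson_tensor f z') UNIV"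
    using has_sum_SigmaD[OF hs] by auto
  then show ?thesis
    unfolding z'_def by (rule has_sum_imp_sums)
qed

text \<open>In the coordinate \<open>x\<close> alone, exp(u) times the transform is an everywhere
  convergent power series with coefficients \<open>site_coeff x f z k / fact k\<close>. It can be
  differentiated term by term; removing the factor exp(u) by the product rule produces the summand
  \<open>- poisson_tensor f z\<close>.\<close>

lemma poisson_tensor_has_partial:
  fixes z :: "real ^ 'v::finite"
  assumes f: "poisson_summable f"
  shows "((\<lambda>t. poisson_tensor f (z + t *\<^sub>R axis x 1)) has_real_derivative
    poisson_tensor (shift_up x f) z - poisson_tensor f z) (at 0)"
proof -
  define c where "c = (\<lambda>k. site_coeff x f z k / fact k)"
  \<comment> \<open>Only coordinate \<open>x\<close> moves, so the same coefficients serve for every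
    t.\<close>
  have line: "z + t *\<^sub>R axis x 1 = (\<chi> v. if v = x then z $ x + t else z $ v)" for t
    by (simp add: vec_eq_iff axis_def)
  have sums: "(\<lambda>k. site_coeff x g z k / fact k * u ^ k) sums
      (exp u * poisson_tensor g (\<chi> v. if v = x then u else z $ v))" if "poisson_summable g" for g u
  proof -
    have "exp u * (site_coeff x g z k * poisson_weight k u) = site_coeff x g z k / fact k * u ^ k" for k
      by (simp add: poisson_weight_def exp_minus field_simps)
    then show ?thesis
      using sums_mult[OF site_coeff_sums[OF that, of x z u], of "exp u"] by simp
  qed
  \<comment> \<open>The factor k+1 from differentiation turns 1/(k+1)! into 1/k!, leaving the
    coefficient of index k+1, which is that of \<open>shift_up x f\<close> at index k.\<close>
  have diffs: "diffs c = (\<lambda>k. site_coeff x (shift_up x f) z k / fact k)"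
    by (simp add: diffs_def c_def site_coeff_shift_up fun_eq_iff del: of_nat_Suc)
  have z: "(\<chi> v. if v = x then z $ x else z $ v) = z"
    by (simp add: vec_eq_iff)
  have "((\<lambda>u. \<Sum>k. c k * u ^ k) has_real_derivative (\<Sum>k. diffs c k * (z $ x) ^ k)) (at (z $ x))"
    unfolding c_def by (rule termdiffs_strong_converges_everywhere) (rule sums_summable[OF sums[OF f]])
  \<comment> \<open>The point is written \<open>0 + z $ x\<close> to fit \<open>DERIV_shift\<close>,
    which moves the base point to t = 0.\<close>
  hence "((\<lambda>u. \<Sum>k. c k * u ^ k) has_real_derivative exp (z $ x) * poisson_tensor (shift_up x f) z)
      (at (0 + z $ x))"
    unfolding diffs sums_unique[OF sums[OF poisson_summable_shift_up[OF f]], symmetric] z by simp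
  hence "((\<lambda>t. \<Sum>k. c k * (z $ x + t) ^ k) has_real_derivative
      exp (z $ x) * poisson_tensor (shift_up x f) z) (at 0)"
    by (subst (asm) DERIV_shift) (simp only: add.commute)
  hence prod: "((\<lambda>t. exp (z $ x + t) * poisson_tensor f (z + t *\<^sub>R axis x 1)) has_real_derivative
      exp (z $ x) * poisson_tensor (shift_up x f) z) (at 0)"
    unfolding c_def line sums_unique[OF sums[OF f], symmetric] .
  have "((\<lambda>t. exp (- (z $ x + t))) has_real_derivative - exp (- (z $ x))) (at 0)"
    by (auto intro!: derivative_eq_intros)
  from DERIV_mult[OF this prod]
  have "((\<lambda>t. exp (- (z $ x + t)) * (exp (z $ x + t) * poisson_tensor f (z + t *\<^sub>R axis x 1)))
      has_real_derivative poisson_tensor (shift_up x f) z - poisson_tensor f z) (at 0)"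
    by (simp add: exp_minus field_simps)
  then show ?thesis
    by (simp add: mult.assoc[symmetric] flip: exp_add)
qed

lemma partial_poisson_tensor:
  "poisson_summable f \<Longrightarrow>
    partial x (poisson_tensor f) z = poisson_tensor (shift_up x f) z - poisson_tensor f z"
  unfolding partial_def by (rule DERIV_imp_deriv[OF poisson_tensor_has_partial])

section \<open>Intertwining of the generators\<close>

definition shift_diff :: "'v \<Rightarrow> 'v \<Rightarrow> (('v \<Rightarrow> nat) \<Rightarrow> real) \<Rightarrow> ('v \<Rightarrow> nat) \<Rightarrow> real" where
  "shift_diff x y f n = shift_up x f n - shift_up y f n"

lemma poisson_summable_shift_diff: "poisson_summable f \<Longrightarrow> poisson_summable (shift_diff x y f)"
  unfolding shift_diff_def[abs_def] by (intro poisson_summable_diff poisson_summable_shift_up)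

text \<open>The two summands \<open>- poisson_tensor f\<close> cancel. Equality of functions, not
  just of values at a point, allows a second application for the squared operator.\<close>

lemma partial_diff_poisson_tensor:
  assumes "poisson_summable f"
  shows "partial_diff x y (poisson_tensor f) = poisson_tensor (shift_diff x y f)"
  using assms unfolding shift_diff_def[abs_def]
  by (simp add: fun_eq_iff partial_diff_def partial_poisson_tensor poisson_tensor_diff
      poisson_summable_shift_up)

text \<open>With S and M for \<open>shift_up\<close> and \<open>shift_down\<close>, M_x S_y f(n) is
  n_x f(n^{x,y}) and M_x S_x f(n) is n_x f(n). Expanding (M_y - M_x)(S_x - S_y) gives the \<beta>
  part. In M_x M_y (S_x - S_y)^2 the mixed terms give -2 n_x n_y f(n) and the squares give the two
  jumps, which is the \<sigma> part.\<close>

lemma particle_edge_gen_eq_shifts: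
  assumes "x \<noteq> y"
  shows "particle_edge_gen \<sigma> \<beta> x y f = (\<lambda>n.
    \<beta> * (shift_down y (shift_diff x y f) n - shift_down x (shift_diff x y f) n)
    + \<sigma> * shift_down x (shift_down y (shift_diff x y (shift_diff x y f))) n)"
proof
  fix n
  show "particle_edge_gen \<sigma> \<beta> x y f n =
    \<beta> * (shift_down y (shift_diff x y f) n - shift_down x (shift_diff x y f) n)
    + \<sigma> * shift_down x (shift_down y (shift_diff x y (shift_diff x y f))) n"
  \<comment> \<open>The split resolves the truncated subtractions: with particles at both sites the
    updates cancel or commute; otherwise the \<sigma> part vanishes, as does every jump out of an
    empty site.\<close>
  proof (cases "n x"; cases "n y")
    fix a b assume "n x = Suc a" "n y = Suc b"
    then show ?thesis
      using assms
      by (simp add: particle_edge_gen_def shift_down_def shift_diff_def shift_up_def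
          move_particle_def Let_def fun_upd_twist algebra_simps fun_upd_idem)
  qed (use assms in \<open>simp_all add: particle_edge_gen_def shift_down_def shift_diff_def shift_up_def
          move_particle_def Let_def algebra_simps fun_upd_idem\<close>)
qed

lemma poisson_summable_particle_edge_gen:
  assumes "poisson_summable f" "x \<noteq> y"
  shows "poisson_summable (particle_edge_gen \<sigma> \<beta> x y f)"
  unfolding particle_edge_gen_eq_shifts[OF assms(2)]
  by (intro poisson_summable_add poisson_summable_cmult poisson_summable_diff
      poisson_summable_shift_down poisson_summable_shift_diff assms)

lemma poisson_tensor_particle_edge_gen:
  assumes "poisson_summable f" "x \<noteq> y"
  shows "poisson_tensor (particle_edge_gen \<sigma> \<beta> x y f) z =
    diffusion_edge_gen \<sigma> \<beta> x y (poisson_tensor f) z"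
  unfolding particle_edge_gen_eq_shifts[OF assms(2)]
  by (simp add: assms diffusion_edge_gen_def partial_diff_poisson_tensor poisson_tensor_add
      poisson_tensor_diff poisson_tensor_cmult poisson_tensor_shift_down poisson_summable_cmult
      poisson_summable_diff poisson_summable_shift_down poisson_summable_shift_diff)
    (simp add: algebra_simps)

theorem proposition5p1:
  fixes p :: "'v::finite \<Rightarrow> 'v \<Rightarrow> real"
    and \<sigma> \<beta> :: real
    and f :: "('v \<Rightarrow> nat) \<Rightarrow> real"
  assumes "\<And>x y. p x y \<ge> 0"
    and "\<And>x. p x x = 0"
    and "irreducible_rates p"
    and "\<And>z :: real ^ 'v. (\<lambda>n. \<bar>poisson_tensor_term f z n\<bar>) summable_on UNIV"
    and "real_analytic (poisson_tensor f)"
  shows "\<forall>z :: real ^ 'v.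
           (\<lambda>n. \<bar>poisson_tensor_term (particle_gen p \<sigma> \<beta> f) z n\<bar>) summable_on UNIV \<and>
           diffusion_gen p \<sigma> \<beta> (poisson_tensor f) z = poisson_tensor (particle_gen p \<sigma> \<beta> f) z"
proof -
  have f: "poisson_summable f"
    using assms(4) by (simp add: poisson_summable_iff_abs)
  \<comment> \<open>The edge lemmas concern distinct sites; diagonal terms vanish by
    \<open>p x x = 0\<close>.\<close>
  have edge: "poisson_summable (\<lambda>n. p x y * particle_edge_gen \<sigma> \<beta> x y f n)" for x y
    using f assms(2)
    by (cases "x = y")
      (simp_all add: poisson_summable_zero poisson_summable_cmult poisson_summable_particle_edge_gen)
  have edge_eq: "poisson_tensor (\<lambda>n. p x y * particle_edge_gen \<sigma> \<beta> x y f n) z =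
      p x y * diffusion_edge_gen \<sigma> \<beta> x y (poisson_tensor f) z" for x y z
    unfolding poisson_tensor_cmult
    using f assms(2) by (cases "x = y") (simp_all add: poisson_tensor_particle_edge_gen)
  have gen: "poisson_summable (particle_gen p \<sigma> \<beta> f)"
    unfolding particle_gen_def[abs_def] by (intro poisson_summable_sum edge finite)
  have "diffusion_gen p \<sigma> \<beta> (poisson_tensor f) z = poisson_tensor (particle_gen p \<sigma> \<beta> f) z" for z
    unfolding particle_gen_def[abs_def] diffusion_gen_def
    by (simp add: poisson_tensor_sum poisson_summable_sum edge edge_eq)
  with gen show ?thesis
    by (simp add: poisson_summable_iff_abs)
qed

end
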